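(* Let $G$ be a finite simple connected graph with $m\geq 1$ edges. Then $$SDD(G)\geq \frac{2m^{2}}{M_{2}(G)}\qquad\text{and}\qquad SDD(G)\geq \frac{4m^{2}}{F(G)}.$$ In each of the two inequalities, equality holds if and only if $G\cong K_{2}$.
   Context: For a finite simple graph $G$ with edge set $E_G$, $d_u$ denotes the degree of vertex $u$. The symmetric division deg index is $SDD(G)=\sum_{uv\in E_G}\left(\frac{d_u}{d_v}+\frac{d_v}{d_u}\right)$, the second Zagreb index is $M_2(G)=\sum_{uv\in E_G}d_ud_v$, and the forgotten index is $F(G)=\sum_{uv\in E_G}(d_u^2+d_v^2)$. *)

theory Defs
  imports Complex_Main "Graph_Theory.Graph_Theory"
begin

text \<open>
  The locale \<^locale>\<open>graph\<close> represents a finite simple graph by a finite symmetric digraph without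
  loops and parallel arcs: an undirected edge $uv$ is the pair of arcs from $u$ to $v$ and from $v$
  to $u$. The indices below are taken over the undirected edges, so that each edge counts once.
\<close>

definition uedges :: "('a, 'b) pre_digraph \<Rightarrow> 'a set set" where
  "uedges G = {{u, v} | u v. u \<rightarrow>\<^bsub>G\<^esub> v}"

definition vdegree :: "('a, 'b) pre_digraph \<Rightarrow> 'a \<Rightarrow> nat" where
  "vdegree G u = card {e \<in> uedges G. u \<in> e}"

text \<open>
  An edge is a two-element set $\{u, v\}$, so a summand that is symmetric in $u$ and $v$ is written
  as a sum or product over the elements of the edge; see \<open>edge_terms\<close> for the expanded form.
\<close>

definition SDD :: "('a, 'b) pre_digraph \<Rightarrow> real" where
  "SDD G = (\<Sum>e\<in>uedges G. \<Sum>u\<in>e. \<Sum>v\<in>e - {u}. real (vdegree G u) / real (vdegree G v))"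

definition second_Zagreb :: "('a, 'b) pre_digraph \<Rightarrow> real" where
  "second_Zagreb G = (\<Sum>e\<in>uedges G. \<Prod>u\<in>e. real (vdegree G u))"

definition forgotten_index :: "('a, 'b) pre_digraph \<Rightarrow> real" where
  "forgotten_index G = (\<Sum>e\<in>uedges G. \<Sum>u\<in>e. (real (vdegree G u))\<^sup>2)"

lemma edge_terms:
  fixes d :: "'a \<Rightarrow> real"
  assumes "u \<noteq> v"
  shows "(\<Sum>x\<in>{u, v}. \<Sum>y\<in>{u, v} - {x}. d x / d y) = d u / d v + d v / d u"
    and "(\<Prod>x\<in>{u, v}. d x) = d u * d v"
    and "(\<Sum>x\<in>{u, v}. (d x)\<^sup>2) = (d u)\<^sup>2 + (d v)\<^sup>2"
proof -
  have "{u, v} - {u} = {v}" "{u, v} - {v} = {u}"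
    using assms by auto
  then show "(\<Sum>x\<in>{u, v}. \<Sum>y\<in>{u, v} - {x}. d x / d y) = d u / d v + d v / d u"
    using assms by simp
qed (use assms in auto)

lemma (in graph) vdegree_eq_out_degree: "vdegree G u = out_degree G u"
proof -
  have "bij_betw (\<lambda>a. {tail G a, head G a}) (out_arcs G u) {e \<in> uedges G. u \<in> e}"
  proof (rule bij_betwI')
    fix a b assume *: "a \<in> out_arcs G u" "b \<in> out_arcs G u"
    show "({tail G a, head G a} = {tail G b, head G b}) = (a = b)"
    proof
      assume "{tail G a, head G a} = {tail G b, head G b}"
      with * have "arc_to_ends G a = arc_to_ends G b"
        by (auto simp: arc_to_ends_def doubleton_eq_iff)
      with * show "a = b"
        by (auto intro: no_multi_arcs)
    qed simp
  next
    fix a assume "a \<in> out_arcs G u"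
    then show "{tail G a, head G a} \<in> {e \<in> uedges G. u \<in> e}"
      by (auto simp: uedges_def arcs_ends_conv)
  next
    fix e assume "e \<in> {e \<in> uedges G. u \<in> e}"
    then obtain x y where xy: "x \<rightarrow>\<^bsub>G\<^esub> y" "e = {x, y}" "u = x \<or> u = y"
      by (auto simp: uedges_def)
    from xy(1) have "y \<rightarrow>\<^bsub>G\<^esub> x"
      using sym_arcs by (auto simp: symmetric_def dest: symD)
    with xy obtain w where "u \<rightarrow>\<^bsub>G\<^esub> w" "e = {u, w}"
      by (metis insert_commute)
    then show "\<exists>a\<in>out_arcs G u. e = {tail G a, head G a}"
      by (force simp: arcs_ends_conv)
  qed
  then show ?thesis
    unfolding vdegree_def out_degree_def by (simp add: bij_betw_same_card)
qed

definition complete_graph :: "nat \<Rightarrow> (nat, nat \<times> nat) pre_digraph" where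
  "complete_graph n =
    with_proj \<lparr>pverts = {..<n}, parcs = {(u, v). u < n \<and> v < n \<and> u \<noteq> v}\<rparr>"

lemma complete_digraph_complete_graph: "K\<^bsub>n\<^esub> (complete_graph n)"
  unfolding complete_graph_def complete_digraph_pair_def by auto

end

theory Submission
  imports Defs
begin

text \<open>
  Every edge has endpoints of degree at least $1$, so by $x/y + y/x \<ge> 2$ the three sums satisfy
  $SDD \<ge> 2m$, $M_2 \<ge> m$ and $F \<ge> 2m$. Hence $SDD \cdot M_2 \<ge> 2m^2$ and $SDD \cdot F \<ge> 4m^2$,
  and equality in either forces $M_2 = m$ or $F = 2m$, that is, all endpoints of edges have
  degree $1$. In a connected graph with an edge this leaves only $K_2$.
\<close>

text \<open>The bound comes from the chain \<open>a * b \<le> a * t \<le> s * t\<close>. Equality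
  makes both links tight, and the positive factors \<open>a\<close> and \<open>t\<close> cancel. In
  the application \<open>s\<close> is \<open>SDD G\<close> and \<open>t\<close> is the other
  index.\<close>

lemma mult_bounds_divide_le:
  fixes a b s t :: real
  assumes "0 < a" "0 < b" "a \<le> s" "b \<le> t"
  shows "a * b / t \<le> s" and "s = a * b / t \<longleftrightarrow> s = a \<and> t = b"
proof -
  have t: "0 < t"
    using assms by simp
  have le: "a * b \<le> a * t" "a * t \<le> s * t"
    using assms t by (simp_all add: mult_mono)
  then show "a * b / t \<le> s"
    unfolding pos_divide_le_eq[OF t] by linarith
  show "s = a * b / t \<longleftrightarrow> s = a \<and> t = b"
  proof
    assume "s = a * b / t"
    then have "s * t = a * b"
      using t by simp
    with le have "a * b = a * t" "a * t = s * t"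
      by linarith+
    with assms t show "s = a \<and> t = b"
      unfolding mult_cancel_left mult_cancel_right by auto
  qed (use t in auto)
qed

lemma sum_divide_flip_ge_2:
  fixes x y :: real
  assumes "0 < x" "0 < y"
  shows "2 \<le> x / y + y / x"
proof -
  have "x / y + y / x - 2 = (x - y)\<^sup>2 / (x * y)"
    using assms by (simp add: field_simps power2_eq_square)
  also have "\<dots> \<ge> 0"
    using assms by simp
  finally show ?thesis
    by simp
qed

text \<open>The differences \<open>f x - c\<close> are nonnegative, so their sum vanishes only if
  each of them does. This carries equality for an index down to the single edges.\<close>

lemma sum_eq_const_iff:
  fixes f :: "'a \<Rightarrow> real"
  assumes "finite A" "\<And>x. x \<in> A \<Longrightarrow> c \<le> f x"
  shows "sum f A = c * card A \<longleftrightarrow> (\<forall>x\<in>A. f x = c)"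
proof -
  have "sum f A = c * card A \<longleftrightarrow> (\<Sum>x\<in>A. f x - c) = 0"
    by (simp add: sum_subtractf mult.commute)
  also have "\<dots> \<longleftrightarrow> (\<forall>x\<in>A. f x - c = 0)"
    using assms by (intro sum_nonneg_eq_0_iff) auto
  finally show ?thesis
    by simp
qed

section \<open>Isomorphism with complete graphs\<close>

lemma digraph_iso_card_verts:
  assumes "digraph_iso G H"
  shows "card (verts H) = card (verts G)"
  using assms
  by (auto simp: digraph_iso_def card_image pre_digraph.digraph_isomorphism_inj_on_verts)

text \<open>Any bijection of the vertices onto \<open>{..<n}\<close> works: without parallel arcs,
  an arc is determined by its ends, and every pair of distinct vertices occurs.\<close>

lemma complete_digraph_iso_complete_graph:
  assumes "K\<^bsub>n\<^esub> G"
  shows "digraph_iso G (complete_graph n)"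
proof -
  interpret graph G
    using assms by (simp add: complete_digraph_def)
  have "card (verts G) = card {..<n}"
    using assms by (simp add: complete_digraph_def)
  then obtain f where f: "bij_betw f (verts G) {..<n}"
    using finite_same_card_bij[OF finite_verts finite_lessThan] by blast
  have ends: "arcs_ends G = {(u, v). (u, v) \<in> verts G \<times> verts G \<and> u \<noteq> v}"
    using assms by (simp add: complete_digraph_def)
  \<comment> \<open>Arcs of \<open>complete_graph n\<close> are pairs of numbers, so an arc must go
    to the pair of images of its ends, with \<open>fst\<close> as tail and \<open>snd\<close> as
    head.\<close>
  define g where "g a = (f (tail G a), f (head G a))" for a
  let ?h = "\<lparr>iso_verts = f, iso_arcs = g, iso_head = snd, iso_tail = fst\<rparr>"
  have inj: "inj_on f (verts G)" and img: "f ` verts G = {..<n}"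
    using f by (auto simp: bij_betw_def)
  have "inj_on g (arcs G)"
  proof (rule inj_onI)
    fix a b assume ab: "a \<in> arcs G" "b \<in> arcs G" "g a = g b"
    then have "arc_to_ends G a = arc_to_ends G b"
      using inj by (auto simp: g_def arc_to_ends_def dest: inj_onD)
    with ab show "a = b"
      by (auto intro: no_multi_arcs)
  qed
  then have "pre_digraph.digraph_isomorphism G ?h"
    using inj wf_digraph_axioms by (auto simp: digraph_isomorphism_def g_def)
  moreover have "g ` arcs G = {(i, j). i < n \<and> j < n \<and> i \<noteq> j}"
  proof -
    have "g ` arcs G = (\<lambda>(u, v). (f u, f v)) ` arcs_ends G"
      by (auto simp: g_def arcs_ends_conv image_image)
    also have "\<dots> = {(i, j). i \<in> f ` verts G \<and> j \<in> f ` verts G \<and> i \<noteq> j}"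
      unfolding ends using inj by (force dest: inj_onD)
    finally show ?thesis
      by (simp add: img)
  qed
  then have "complete_graph n = app_iso ?h G"
    using img by (simp add: complete_graph_def app_iso_def with_proj_def)
  ultimately show ?thesis
    unfolding digraph_iso_def by blast
qed

section \<open>Bounds for the three indices and their equality cases\<close>

context graph
begin

lemma finite_uedges: "finite (uedges G)"
proof -
  have "uedges G \<subseteq> (\<lambda>(u, v). {u, v}) ` arcs_ends G"
    by (auto simp: uedges_def)
  then show ?thesis
    by (rule finite_subset) (simp add: arcs_ends_def)
qed

lemma uedgesE:
  assumes "e \<in> uedges G"
  obtains u v where "e = {u, v}" "u \<noteq> v" "u \<rightarrow> v" "u \<in> verts G" "v \<in> verts G"
  using assms by (auto simp: uedges_def dest: adj_in_verts adj_not_same)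

lemma vdegree_pos:
  assumes "e \<in> uedges G" "u \<in> e"
  shows "1 \<le> vdegree G u"
proof -
  have "{e \<in> uedges G. u \<in> e} \<noteq> {}"
    using assms by auto
  then show ?thesis
    unfolding vdegree_def using finite_uedges by (simp add: Suc_le_eq card_gt_0_iff)
qed

text \<open>The fourth claim is only an implication because \<open>x / y + y / x = 2\<close> holds
  whenever \<open>x = y\<close> is positive: any regular graph makes the \<open>SDD\<close> terms
  minimal. Degree 1 is forced only by the product and by the squares.\<close>

lemma edge_bounds:
  assumes "e \<in> uedges G"
  defines "d \<equiv> \<lambda>u. real (vdegree G u)"
  shows "2 \<le> (\<Sum>u\<in>e. \<Sum>v\<in>e - {u}. d u / d v)" (is ?sdd)
    and "1 \<le> (\<Prod>u\<in>e. d u)" (is ?prod)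
    and "2 \<le> (\<Sum>u\<in>e. (d u)\<^sup>2)" (is ?sq)
    and "(\<forall>u\<in>e. vdegree G u = 1) \<Longrightarrow> (\<Sum>u\<in>e. \<Sum>v\<in>e - {u}. d u / d v) = 2"
      (is "_ \<Longrightarrow> ?sdd_eq")
    and "(\<Prod>u\<in>e. d u) = 1 \<longleftrightarrow> (\<forall>u\<in>e. vdegree G u = 1)" (is ?prod_iff)
    and "(\<Sum>u\<in>e. (d u)\<^sup>2) = 2 \<longleftrightarrow> (\<forall>u\<in>e. vdegree G u = 1)" (is ?sq_iff)
proof -
  obtain u v where e: "e = {u, v}" "u \<noteq> v"
    using assms(1) by (rule uedgesE)
  have d: "1 \<le> d u" "1 \<le> d v"
    using vdegree_pos[OF assms(1)] e by (auto simp: d_def)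
  have all: "(\<forall>u\<in>e. vdegree G u = 1) \<longleftrightarrow> d u = 1 \<and> d v = 1"
    by (simp add: e d_def)
  note t = edge_terms[OF e(2), where d = d, folded e(1)]
  show ?sdd
    using sum_divide_flip_ge_2[of "d u" "d v"] d by (simp add: t)
  \<comment> \<open>A product of factors at least 1 dominates each factor. This reduces the bound to
    linear arithmetic, and a product equal to 1 squeezes both factors to 1.\<close>
  have p: "d u \<le> d u * d v" "d v \<le> d u * d v"
    using d by simp_all
  show ?prod
    unfolding t using d p by linarith
  \<comment> \<open>Likewise, squares summing to 2 leave \<open>d u + d v \<le> 2\<close>, with both
    summands at least 1.\<close>
  have s: "d u \<le> (d u)\<^sup>2" "d v \<le> (d v)\<^sup>2"
    using d by (simp_all add: power2_eq_square)
  show ?sq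
    using d s by (simp add: t)
  show ?sdd_eq if "\<forall>u\<in>e. vdegree G u = 1"
    using that unfolding all by (simp add: t)
  show ?prod_iff
    unfolding all t
  proof
    assume "d u * d v = 1"
    with d p show "d u = 1 \<and> d v = 1"
      by linarith
  qed simp
  show ?sq_iff
    unfolding all t
  proof
    assume "(d u)\<^sup>2 + (d v)\<^sup>2 = 2"
    with d s show "d u = 1 \<and> d v = 1"
      by linarith
  qed simp
qed

lemma SDD_ge: "2 * real (card (uedges G)) \<le> SDD G"
  using sum_mono[of "uedges G" "\<lambda>_. 2 :: real"] edge_bounds(1)
  by (simp add: SDD_def mult.commute)

lemma second_Zagreb_ge: "card (uedges G) \<le> second_Zagreb G"
  using sum_mono[of "uedges G" "\<lambda>_. 1 :: real"] edge_bounds(2)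
  by (simp add: second_Zagreb_def)

lemma forgotten_index_ge: "2 * real (card (uedges G)) \<le> forgotten_index G"
  using sum_mono[of "uedges G" "\<lambda>_. 2 :: real"] edge_bounds(3)
  by (simp add: forgotten_index_def mult.commute)

lemma SDD_eq:
  assumes "\<forall>e\<in>uedges G. \<forall>u\<in>e. vdegree G u = 1"
  shows "SDD G = 2 * real (card (uedges G))"
  unfolding SDD_def using edge_bounds(4) assms by (simp add: mult.commute)

lemma second_Zagreb_eq_iff:
  "second_Zagreb G = card (uedges G) \<longleftrightarrow> (\<forall>e\<in>uedges G. \<forall>u\<in>e. vdegree G u = 1)"
  using sum_eq_const_iff[OF finite_uedges edge_bounds(2)] edge_bounds(5)
  by (simp add: second_Zagreb_def)

lemma forgotten_index_eq_iff:
  "forgotten_index G = 2 * real (card (uedges G)) \<longleftrightarrow> (\<forall>e\<in>uedges G. \<forall>u\<in>e. vdegree G u = 1)"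
  using sum_eq_const_iff[OF finite_uedges edge_bounds(3)] edge_bounds(6)
  by (simp add: forgotten_index_def)

section \<open>Degree 1 at all edges characterizes \<open>K2\<close>\<close>

lemma vdegree_eq_1_if_card_verts_2:
  assumes "card (verts G) = 2" "e \<in> uedges G" "u \<in> e"
  shows "vdegree G u = 1"
proof -
  \<comment> \<open>On two vertices, the full vertex set is the only possible edge.\<close>
  have "e' = verts G" if e': "e' \<in> uedges G" for e'
  proof -
    obtain x y where "e' = {x, y}" "x \<noteq> y" "x \<in> verts G" "y \<in> verts G"
      using e' by (rule uedgesE)
    then show ?thesis
      using assms(1) by (intro card_subset_eq) auto
  qed
  with assms(2,3) have "{e' \<in> uedges G. u \<in> e'} = {verts G}"
    by auto
  then show ?thesis
    by (simp add: vdegree_def)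
qed

text \<open>No arc leads out of a fixed edge \<open>e\<close>, since it would give an endpoint of
  \<open>e\<close> a second edge. Hence everything reachable from \<open>e\<close>, which is all of
  \<open>G\<close> by connectedness, lies in \<open>e\<close>.\<close>

lemma complete_digraph_2_if_vdegree_eq_1:
  assumes "connected G" "uedges G \<noteq> {}"
    and deg: "\<forall>e\<in>uedges G. \<forall>u\<in>e. vdegree G u = 1"
  shows "K\<^bsub>2\<^esub> G"
proof -
  obtain e where e: "e \<in> uedges G"
    using assms(2) by auto
  then obtain u v where uv: "e = {u, v}" "u \<noteq> v" "u \<rightarrow> v" "u \<in> verts G" "v \<in> verts G"
    by (rule uedgesE)
  have closed: "y \<in> e" if "x \<rightarrow> y" "x \<in> e" for x y
  proof -
    have xy: "{x, y} \<in> uedges G"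
      using that(1) by (auto simp: uedges_def)
    have "card {e \<in> uedges G. x \<in> e} = 1"
      using deg e that(2) by (auto simp: vdegree_def)
    then obtain c where c: "{e \<in> uedges G. x \<in> e} = {c}"
      by (rule card_1_singletonE)
    have "{x, y} \<in> {e \<in> uedges G. x \<in> e}" "e \<in> {e \<in> uedges G. x \<in> e}"
      using xy e that(2) by simp_all
    then have "{x, y} = c" "e = c"
      unfolding c by simp_all
    then show ?thesis
      by auto
  qed
  \<comment> \<open>\<open>connected\<close> ignores the direction of arcs; symmetry turns it into
    reachability along arcs, over which \<open>closed\<close> can be iterated.\<close>
  have "strongly_connected G"
    using assms(1) symmetric_connected_imp_strongly_connected sym_arcs by blast
  have "w \<in> e" if "w \<in> verts G" for w
  proof -
    have "u \<rightarrow>\<^sup>* w"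
      using \<open>strongly_connected G\<close> uv(4) that by (auto simp: strongly_connected_def)
    then show ?thesis
    proof (induction rule: reachable_induct)
      case base
      show ?case
        by (simp add: uv(1))
    qed (rule closed)
  qed
  then have verts: "verts G = {u, v}"
    using uv by auto
  have "v \<rightarrow> u"
    using uv(3) sym_arcs by (auto simp: symmetric_def dest: symD)
  have "arcs_ends G \<subseteq> {(x, y). (x, y) \<in> verts G \<times> verts G \<and> x \<noteq> y}"
    using adj_in_verts adj_not_same by auto
  moreover have "{(x, y). (x, y) \<in> verts G \<times> verts G \<and> x \<noteq> y} \<subseteq> arcs_ends G"
    using uv(3) \<open>v \<rightarrow> u\<close> by (auto simp: verts)
  ultimately show ?thesis
    using graph_axioms uv(2) by (simp add: complete_digraph_def verts subset_antisym)
qed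

lemma vdegree_eq_1_iff_iso_K2:
  assumes "connected G" "uedges G \<noteq> {}"
  shows "(\<forall>e\<in>uedges G. \<forall>u\<in>e. vdegree G u = 1) \<longleftrightarrow> digraph_iso G (complete_graph 2)"
proof
  assume "digraph_iso G (complete_graph 2)"
  \<comment> \<open>Only the number of vertices has to be carried across the isomorphism.\<close>
  moreover have "card (verts (complete_graph 2)) = 2"
    by (simp add: complete_graph_def)
  ultimately have "card (verts G) = 2"
    by (simp add: digraph_iso_card_verts)
  then show "\<forall>e\<in>uedges G. \<forall>u\<in>e. vdegree G u = 1"
    using vdegree_eq_1_if_card_verts_2 by blast
qed (use assms complete_digraph_2_if_vdegree_eq_1 complete_digraph_iso_complete_graph in blast)

end

theorem theorem3p7:
  fixes G :: "('a, 'b) pre_digraph" and m :: nat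
  assumes "graph G"
    and "Digraph_Component.connected G"
    and "m = card (uedges G)"
    and "m \<ge> 1"
  shows "SDD G \<ge> 2 * (real m)\<^sup>2 / second_Zagreb G \<and>
    SDD G \<ge> 4 * (real m)\<^sup>2 / forgotten_index G \<and>
    (SDD G = 2 * (real m)\<^sup>2 / second_Zagreb G \<longleftrightarrow> digraph_iso G (complete_graph 2)) \<and>
    (SDD G = 4 * (real m)\<^sup>2 / forgotten_index G \<longleftrightarrow> digraph_iso G (complete_graph 2))"
proof -
  interpret graph G
    by fact
  have pos: "0 < 2 * real m" "0 < real m"
    using assms(4) by simp_all
  \<comment> \<open>The numerators are split as \<open>a * b\<close>, where \<open>a = 2 * m\<close>
    bounds \<open>SDD G\<close> and \<open>b\<close> bounds the other index.\<close>
  have eqs: "2 * (real m)\<^sup>2 = 2 * real m * real m" "4 * (real m)\<^sup>2 = 2 * real m * (2 * real m)"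
    by (simp_all add: power2_eq_square)
  have "uedges G \<noteq> {}"
    using assms(3,4) by auto
  note iso = vdegree_eq_1_iff_iso_K2[OF assms(2) this]
  note ge = SDD_ge second_Zagreb_ge forgotten_index_ge
  note M = mult_bounds_divide_le[OF pos ge(1,2)[folded assms(3)]]
  note F = mult_bounds_divide_le[OF pos(1) pos(1) ge(1,3)[folded assms(3)]]
  have "SDD G = 2 * real m * real m / second_Zagreb G \<longleftrightarrow> digraph_iso G (complete_graph 2)"
    \<comment> \<open>Of the two tight bounds, the one for \<open>second_Zagreb\<close> already
      means that all these degrees are 1, and \<open>SDD_eq\<close> then supplies the other.\<close>
    unfolding M(2) iso[symmetric] using SDD_eq second_Zagreb_eq_iff assms(3) by auto
  moreover have
    "SDD G = 2 * real m * (2 * real m) / forgotten_index G \<longleftrightarrow> digraph_iso G (complete_graph 2)"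
    unfolding F(2) iso[symmetric] using SDD_eq forgotten_index_eq_iff assms(3) by auto
  ultimately show ?thesis
    unfolding eqs using M(1) F(1) by blast
qed

end
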